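(* For given $L$, let $\Xi(L)=\mathcal D^\intercal\big((I+\mathcal B L)^\intercal\mathcal Q(I+\mathcal B L)+L^\intercal\mathcal R L\big)\mathcal D\succeq0$. The distributionally robust quadratic cost $$\max_{\mathbb P\in\mathbb B^{\|\cdot\|}_\varepsilon(\hat{\mathbb P})}\mathbb E_{\mathbb P}\big[w^\intercal\,\Xi(L)\,w\big],\qquad \hat{\mathbb P}=\mathcal N(0,\Sigma_w),$$ is equivalent to (has the same optimal value as) the convex program $$\min_{\lambda I\succ\Xi(L)}\ \lambda\Big(\varepsilon^2-\operatorname{tr}[\Sigma_w]+\lambda\operatorname{tr}\big[\Sigma_w(\lambda I-\Xi(L))^{-1}\big]\Big).$$
   Context: $N,n,m,d$ are positive integers and $A\in\mathbb R^{n\times n}$, $B\in\mathbb R^{n\times m}$, $D\in\mathbb R^{n\times d}$. The matrices $\mathcal B\in\mathbb R^{(N+1)n\times Nm}$ and $\mathcal D\in\mathbb R^{(N+1)n\times Nd}$ have $(k,i)$ block ($k=0,\dots,N$, $i=0,\dots,N-1$) equal to $A^{k-1-i}B$, respectively $A^{k-1-i}D$, if $i<k$ and $0$ otherwise; they come from stacking $x_{k+1}=Ax_k+Bu_k+Dw_k$. $L\in\mathbb R^{Nm\times(N+1)n}$ is of the form $L=K(I-\mathcal B K)^{-1}$ with $K$ a block lower-triangular stacked feedback gain. $\mathcal Q=\mathrm{blkdiag}(Q_0,\dots,Q_{N-1},0)$ with $Q_k\in\mathbb R^{n\times n}$, $Q_k\succeq0$, and $\mathcal R=\mathrm{blkdiag}(R_0,\dots,R_{N-1})$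 with $R_k\in\mathbb R^{m\times m}$, $R_k\succ0$. $\Sigma_w\in\mathbb R^{Nd\times Nd}$, $\Sigma_w\succ0$, and $\varepsilon>0$. The Wasserstein ambiguity set is $\mathbb B^{\|\cdot\|}_\varepsilon(\hat{\mathbb P})=\{\mathbb Q\in\mathcal P_2(\mathbb R^{Nd}):\mathbb W(\mathbb Q,\hat{\mathbb P})\le\varepsilon\}$, where $\mathcal P_2$ denotes probability distributions with finite second moment and $\mathbb W$ is the type-2 Wasserstein distance with Euclidean cost. Max and min refer to optimal values (suprema and infima). *)

theory Defs
  imports "HOL-Probability.Probability"
begin

text \<open>
  Matrices of size $r \times c$ have type \<^typ>\<open>real^'c^'r\<close>; all dimensions are cardinalities of
  finite (hence nonempty) index types. A stacked vector in $R^{Nd}$ is indexed by pairs (stage,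
  component), i.e. has type \<^typ>\<open>real^('N \<times> 'd)\<close>. The stages $0,\dots,N-1$ of the horizon are the
  elements of a finite linear order \<open>'N\<close>, numbered by \<open>stage\<close>. States live at the $N+1$ times
  $0,\dots,N$, represented by \<open>'N option\<close>, where \<open>None\<close> is the terminal time $N$.
\<close>

definition stage :: "'N::{finite,linorder} \<Rightarrow> nat" where
  "stage i = card {j. j < i}"

definition state_time :: "'N::{finite,linorder} option \<Rightarrow> nat" where
  "state_time k = (case k of None \<Rightarrow> CARD('N) | Some i \<Rightarrow> stage i)"

lemma stage_strict_mono: "i < j \<Longrightarrow> stage i < stage (j :: 'N::{finite,linorder})"
  unfolding stage_def by (rule psubset_card_mono) auto

lemma bij_betw_stage: "bij_betw stage (UNIV :: 'N::{finite,linorder} set) {..<CARD('N)}"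
proof -
  have inj: "inj (stage :: 'N \<Rightarrow> nat)"
    by (rule injI) (metis linorder_less_linear nat_neq_iff stage_strict_mono)
  have "stage i < CARD('N)" for i :: 'N
    unfolding stage_def by (rule psubset_card_mono) auto
  then have "range (stage :: 'N \<Rightarrow> nat) \<subseteq> {..<CARD('N)}"
    by auto
  moreover have "card (range (stage :: 'N \<Rightarrow> nat)) = card {..<CARD('N)}"
    using inj by (simp add: card_image)
  ultimately have "range (stage :: 'N \<Rightarrow> nat) = {..<CARD('N)}"
    by (intro card_subset_eq) auto
  with inj show ?thesis
    by (simp add: bij_betw_def)
qed

lemma bij_betw_state_time:
  "bij_betw state_time (UNIV :: 'N::{finite,linorder} option set) {..CARD('N)}"
proof -
  have stages: "stage ` (UNIV :: 'N set) = {..<CARD('N)}" "inj (stage :: 'N \<Rightarrow> nat)"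
    using bij_betw_stage by (auto simp: bij_betw_def)
  then have "stage i < CARD('N)" for i :: 'N
    by auto
  then have neq: "stage i \<noteq> CARD('N)" "CARD('N) \<noteq> stage i" for i :: 'N
    by (simp_all add: less_not_refl2 less_not_refl3)
  have "inj (state_time :: 'N option \<Rightarrow> nat)"
  proof (rule injI)
    fix k l :: "'N option"
    assume "state_time k = state_time l"
    then show "k = l"
      using neq stages(2) by (cases k; cases l) (auto simp: state_time_def dest: injD)
  qed
  moreover have "range (state_time :: 'N option \<Rightarrow> nat) = insert (CARD('N)) (range (stage :: 'N \<Rightarrow> nat))"
    by (auto simp: UNIV_option_conv state_time_def image_iff)
  ultimately show ?thesis
    by (auto simp: bij_betw_def stages)
qed


subsection \<open>Matrices\<close>

text \<open>The operation \<^term>\<open>(^)\<close> on vectors of vectors would be componentwise.\<close>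

primrec matpow :: "real^'n^'n \<Rightarrow> nat \<Rightarrow> real^'n^'n" where
  "matpow A 0 = mat 1"
| "matpow A (Suc k) = A ** matpow A k"

definition psd_matrix :: "real^'k^'k \<Rightarrow> bool" where
  "psd_matrix M \<longleftrightarrow> transpose M = M \<and> (\<forall>x. 0 \<le> x \<bullet> (M *v x))"

definition pd_matrix :: "real^'k^'k \<Rightarrow> bool" where
  "pd_matrix M \<longleftrightarrow> transpose M = M \<and> (\<forall>x. x \<noteq> 0 \<longrightarrow> 0 < x \<bullet> (M *v x))"

definition blkdiag :: "('i::finite \<Rightarrow> real^'a^'a) \<Rightarrow> real^('i \<times> 'a)^('i \<times> 'a)" where
  "blkdiag M = (\<chi> p q. if fst p = fst q then M (fst p) $ snd p $ snd q else 0)"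

text \<open>For $x_{k+1} = A x_k + E v_k$, the matrix mapping the stacked input $v$ to the stacked state
  $x$ when $x_0 = 0$.\<close>

definition stacked_input ::
  "real^'n^'n \<Rightarrow> real^'e^'n \<Rightarrow> real^('N::{finite,linorder} \<times> 'e)^('N option \<times> 'n)" where
  "stacked_input A E = (\<chi> p q.
     if stage (fst q) < state_time (fst p)
     then (matpow A (state_time (fst p) - 1 - stage (fst q)) ** E) $ snd p $ snd q
     else 0)"

text \<open>Causality of a stacked state feedback: the input at stage \<open>i\<close> only uses states at times
  up to \<open>i\<close>.\<close>

definition block_lower_triangular ::
  "real^('N::{finite,linorder} option \<times> 'n::finite)^('N \<times> 'm::finite) \<Rightarrow> bool" where
  "block_lower_triangular K \<longleftrightarrow>
     (\<forall>i a k b. stage i < state_time k \<longrightarrow> K $ (i, a) $ (k, b) = 0)"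

definition Xi ::
  "real^'n^'n \<Rightarrow> real^'m^'n \<Rightarrow> real^'d^'n \<Rightarrow>
   ('N::{finite,linorder} \<Rightarrow> real^'n^'n) \<Rightarrow> ('N \<Rightarrow> real^'m^'m) \<Rightarrow>
   real^('N option \<times> 'n)^('N \<times> 'm) \<Rightarrow> real^('N \<times> 'd)^('N \<times> 'd)" where
  "Xi A B D Q R L =
     (let BB = stacked_input A B;
          DD = stacked_input A D;
          QQ = blkdiag (case_option 0 Q);
          RR = blkdiag R;
          M = mat 1 + BB ** L
      in transpose DD ** (transpose M ** QQ ** M + transpose L ** RR ** L) ** DD)"


subsection \<open>Wasserstein ambiguity sets\<close>

definition P2 :: "('a::euclidean_space) measure set" where
  "P2 = {P. prob_space P \<and> sets P = sets borel \<and> integrable P (\<lambda>x. (norm x)\<^sup>2)}"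

definition couplings ::
  "('a::euclidean_space) measure \<Rightarrow> 'a measure \<Rightarrow> ('a \<times> 'a) measure set" where
  "couplings P Q = {\<pi>. prob_space \<pi> \<and> sets \<pi> = sets (borel \<Otimes>\<^sub>M borel) \<and>
     distr \<pi> borel fst = P \<and> distr \<pi> borel snd = Q}"

text \<open>Only meaningful for arguments in \<open>P2\<close>: there the integrals below are finite and the set of
  couplings is nonempty.\<close>

definition wasserstein2 :: "('a::euclidean_space) measure \<Rightarrow> 'a measure \<Rightarrow> real" where
  "wasserstein2 P Q =
     sqrt (INF \<pi>\<in>couplings P Q. \<integral>z. (norm (fst z - snd z))\<^sup>2 \<partial>\<pi>)"

definition wasserstein_ball :: "('a::euclidean_space) measure \<Rightarrow> real \<Rightarrow> 'a measure set" where
  "wasserstein_ball P r = {Q \<in> P2. wasserstein2 Q P \<le> r}"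

text \<open>The normal distribution $N(0,\Sigma)$ for positive definite $\Sigma$.\<close>

definition centered_normal :: "real^'k^'k \<Rightarrow> (real^'k) measure" where
  "centered_normal S = density lborel
     (\<lambda>x. ennreal (exp (- (x \<bullet> (matrix_inv S *v x)) / 2) / sqrt ((2 * pi) ^ CARD('k) * det S)))"


subsection \<open>The dual objective\<close>

definition dual_feasible :: "real^'k^'k \<Rightarrow> real set" where
  "dual_feasible X = {l. pd_matrix (mat l - X)}"

definition dual_objective :: "real^'k^'k \<Rightarrow> real^'k^'k \<Rightarrow> real \<Rightarrow> real \<Rightarrow> real" where
  "dual_objective S X \<epsilon> l =
     l * (\<epsilon>\<^sup>2 - trace S + l * trace (S ** matrix_inv (mat l - X)))"

end

theory Submission
  imports Defs
begin

text \<open>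
  Since $X = \Xi(L)$ is symmetric and positive semidefinite, there is an orthogonal $U$ with
  $X = U\,\mathrm{diag}(x_j)\,U^T$ and $x_j \ge 0$. Every matrix in the statement that depends on
  $\lambda$ is a function of $X$, so with the weights $a_j = u_j^T \Sigma u_j > 0$ (where $u_j$ is
  column $j$ of $U$) the dual objective becomes the scalar expression
  $$\lambda\varepsilon^2 + \sum_j a_j \frac{\lambda x_j}{\lambda - x_j}
    = \lambda\varepsilon^2 + \sum_j a_j \Big(x_j + \frac{x_j^2}{\lambda - x_j}\Big),$$
  feasibility means $\lambda > \max_j x_j$, and convexity can be read off the right-hand side.

  \<^bold>\<open>Upper bound.\<close> Completing the square in each eigendirection gives, for feasible $\lambda$,
  $$w^T X w \le \lambda \|w - v\|^2 +
    v^T U\,\mathrm{diag}\Big(\frac{\lambda x_j}{\lambda - x_j}\Big) U^T v.$$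
  Integrating this over a nearly optimal coupling bounds the expected cost of every distribution in
  the ball by the dual objective (\<open>wasserstein_weak_duality\<close>). The second
  term turns into the sum above because a quadratic form $M$ has expectation
  $\mathrm{tr}(\Sigma M)$ under the normal distribution (\<open>centered_normal_moments\<close>).

  \<^bold>\<open>Attainment.\<close> Equality in the square holds for $w = \lambda(\lambda I - X)^{-1} v$. Pushing the
  normal distribution forward along this linear map costs
  $\sum_j a_j x_j^2/(\lambda - x_j)^2$. If $X \ne 0$, this quantity runs from
  infinity down to $0$ as $\lambda$ increases, so it equals $\varepsilon^2$ for some $\lambda$
  (\<open>dual_stationary_point_exists\<close>); for that $\lambda$ the pushforward lies in the ball and its
  expected cost is the dual objective at $\lambda$. If $X = 0$, the maximum is $0$ and the dual
  objective $\lambda\varepsilon^2$ approaches $0$ without attaining it.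
\<close>

section \<open>Symmetric matrices and their functional calculus\<close>

text \<open>
  A maximizer of the Rayleigh quotient $x \<bullet> f x$ on the unit sphere of the subspace is an
  eigenvector: moving from it in the direction of the residual $w = f u - c u$ changes the quotient
  by $2t\|w\|^2$ to first order, so the residual must vanish.
\<close>
lemma self_adjoint_eigenvector_in_invariant_subspace:
  fixes f :: "'a::euclidean_space \<Rightarrow> 'a"
  assumes lin: "linear f" and sym: "\<And>x y. f x \<bullet> y = x \<bullet> f y"
    and V: "subspace V" "\<And>x. x \<in> V \<Longrightarrow> f x \<in> V" and v: "v \<in> V" "v \<noteq> 0"
  obtains u c where "u \<in> V" "norm u = 1" "f u = c *\<^sub>R u"
proof -
  let ?S = "sphere 0 1 \<inter> V"
  have "compact ?S"
    using V(1) by (intro compact_Int_closed closed_subspace) auto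
  moreover have "sgn v \<in> ?S"
    using v V(1) by (auto simp: sgn_div_norm subspace_scale)
  moreover have "continuous_on ?S (\<lambda>x. x \<bullet> f x)"
    using linear_continuous_on[of f] lin
    by (intro continuous_intros) (simp add: linear_conv_bounded_linear)
  ultimately obtain u where u: "u \<in> ?S" and max: "\<And>y. y \<in> ?S \<Longrightarrow> y \<bullet> f y \<le> u \<bullet> f u"
    using continuous_attains_sup[of ?S "\<lambda>x. x \<bullet> f x"] by blast
  define c where "c = u \<bullet> f u"
  have uu: "u \<bullet> u = 1"
    using u by (simp add: dot_square_norm)
  have bound: "y \<bullet> f y \<le> c * (y \<bullet> y)" if "y \<in> V" for y
  proof (cases "y = 0")
    case True
    then show ?thesis by simp
  next
    case False
    have "sgn y \<bullet> f (sgn y) \<le> c"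
      unfolding c_def using False that V(1)
      by (intro max) (auto simp: sgn_div_norm subspace_scale)
    also have "sgn y \<bullet> f (sgn y) = (y \<bullet> f y) / (y \<bullet> y)"
      using lin by (simp add: sgn_div_norm linear_scale dot_square_norm power2_eq_square field_simps)
    finally show ?thesis
      using False by (simp add: field_simps)
  qed
  define w where "w = f u - c *\<^sub>R u"
  have wV: "w \<in> V"
    using u V by (simp add: w_def subspace_diff subspace_scale)
  have "w \<bullet> u = f u \<bullet> u - c * (u \<bullet> u)"
    by (simp add: w_def inner_diff_left)
  then have wu: "w \<bullet> u = 0"
    using uu by (simp add: c_def inner_commute)
  have "f u = w + c *\<^sub>R u"
    by (simp add: w_def)
  then have wfu: "w \<bullet> f u = w \<bullet> w"
    using wu by (simp add: inner_add_right)
  define b where "b = c * (w \<bullet> w) - w \<bullet> f w"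
  have quad: "2 * t * (w \<bullet> w) \<le> t\<^sup>2 * b" for t
  proof -
    have "u + t *\<^sub>R w \<in> V"
      using u wV V(1) by (simp add: subspace_add subspace_scale)
    from bound[OF this] have
      "u \<bullet> f u + t * (u \<bullet> f w) + (t * (w \<bullet> f u) + t * t * (w \<bullet> f w)) \<le>
        c * (u \<bullet> u + t * (u \<bullet> w) + (t * (w \<bullet> u) + t * t * (w \<bullet> w)))"
      using lin by (simp add: linear_add linear_scale inner_add_left inner_add_right algebra_simps)
    moreover have "u \<bullet> f w = w \<bullet> w"
      using sym[of u w] wfu by (simp add: inner_commute)
    ultimately show ?thesis
      using uu wu wfu by (simp add: c_def b_def inner_commute power2_eq_square algebra_simps)
  qed
  have "w \<bullet> w \<le> 0"
  proof (cases "b \<le> 0")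
    case True
    with quad[of 1] show ?thesis by simp
  next
    case False
    \<comment> \<open>the step size that maximizes $2 t (w \<bullet> w) - t^2 b$\<close>
    with quad[of "(w \<bullet> w) / b"] have "(w \<bullet> w)\<^sup>2 / b \<le> 0"
      by (simp add: power2_eq_square)
    with False show ?thesis
      by (simp add: divide_le_0_iff)
  qed
  then have "w = 0"
    by (metis inner_eq_zero_iff inner_ge_zero order_antisym)
  then have "f u = c *\<^sub>R u"
    by (simp add: w_def)
  with u show thesis
    by (intro that[of u c]) auto
qed

text \<open>
  An orthonormal system of eigenvectors of largest size spans the space: otherwise its orthogonal
  complement, which is invariant because \<open>f\<close> is self-adjoint, would contain a further eigenvector.
\<close>
lemma self_adjoint_orthonormal_eigenbasis:
  fixes f :: "'a::euclidean_space \<Rightarrow> 'a"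
  assumes lin: "linear f" and sym: "\<And>x y. f x \<bullet> y = x \<bullet> f y"
  obtains B where "finite B" "card B = DIM('a)" "pairwise orthogonal B"
    "\<And>b. b \<in> B \<Longrightarrow> norm b = 1" "\<And>b. b \<in> B \<Longrightarrow> \<exists>c. f b = c *\<^sub>R b"
proof -
  define good where "good B \<longleftrightarrow> pairwise orthogonal B \<and> (\<forall>b\<in>B. norm b = 1 \<and> (\<exists>c. f b = c *\<^sub>R b))"
    for B :: "'a set"
  have indep: "independent B" if "good B" for B
    using that by (intro pairwise_orthogonal_independent) (auto simp: good_def)
  have "good {}"
    by (simp add: good_def)
  moreover have "\<forall>B. good B \<longrightarrow> card B < Suc DIM('a)"
    using indep independent_bound by (auto simp: less_Suc_eq_le)
  ultimately obtain B where B: "good B" and max: "\<And>C. good C \<Longrightarrow> card C \<le> card B"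
    using ex_has_greatest_nat[of good "{}" card "Suc DIM('a)"] by auto
  have fin: "finite B"
    using indep[OF B] independent_bound by auto
  have "card B = DIM('a)"
  proof (rule ccontr)
    assume "card B \<noteq> DIM('a)"
    then have "dim B < DIM('a)"
      using indep[OF B] independent_bound[of B] dim_eq_card_independent[of B] by simp
    then obtain v where v: "v \<noteq> 0" "\<And>y. y \<in> span B \<Longrightarrow> orthogonal v y"
      using orthogonal_to_subspace_exists[of B] by blast
    define V where "V = {x. \<forall>b\<in>B. b \<bullet> x = 0}"
    have "subspace V"
      by (auto simp: V_def subspace_def inner_add_right)
    moreover have "f x \<in> V" if "x \<in> V" for x
    proof -
      have "b \<bullet> f x = 0" if "b \<in> B" for b
      proof -
        obtain c where "f b = c *\<^sub>R b"
          using B \<open>b \<in> B\<close> by (auto simp: good_def)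
        then show ?thesis
          using sym[of b x] \<open>x \<in> V\<close> \<open>b \<in> B\<close> by (simp add: V_def)
      qed
      then show ?thesis by (simp add: V_def)
    qed
    moreover have "v \<in> V"
      using v(2) by (auto simp: V_def orthogonal_def span_base inner_commute)
    ultimately obtain u c where u: "u \<in> V" "norm u = 1" "f u = c *\<^sub>R u"
      using self_adjoint_eigenvector_in_invariant_subspace[OF lin sym, of V v] v(1) by metis
    have "u \<notin> B"
      using u by (auto simp: V_def)
    moreover have "good (insert u B)"
      using B u by (auto simp: good_def V_def pairwise_insert orthogonal_def inner_commute)
    ultimately show False
      using max[of "insert u B"] fin by simp
  qed
  with B fin show thesis
    by (intro that[of B]) (auto simp: good_def)
qed

text \<open>
  If the orthogonal matrix \<open>U\<close> diagonalizes $X$ with eigenvalues $x_j$, then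
  \<open>spectral_matrix U (\<lambda>j. \<phi> (x j))\<close> is $\phi(X)$; the lemmas below are the
  functional calculus of $X$ in this form.
\<close>
definition spectral_matrix :: "real^'k^'k \<Rightarrow> ('k \<Rightarrow> real) \<Rightarrow> real^'k^'k" where
  "spectral_matrix U g = U ** (\<chi> i j. if i = j then g i else 0) ** transpose U"

lemma spectral_matrix_nth:
  "spectral_matrix U g $ i $ j = (\<Sum>k\<in>UNIV. g k * U $ i $ k * U $ j $ k)"
  by (simp add: spectral_matrix_def matrix_matrix_mult_def transpose_def if_distrib
      cong: if_cong) (simp add: mult_ac)

theorem symmetric_matrix_diagonalization:
  fixes M :: "real^'k^'k"
  assumes "transpose M = M"
  obtains U g where "orthogonal_matrix U" "M = spectral_matrix U g"
proof -
  have lin: "linear ((*v) M)"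
    by simp
  have sym: "(M *v x) \<bullet> y = x \<bullet> (M *v y)" for x y
    by (metis assms dot_lmul_matrix vector_transpose_matrix)
  obtain B where B: "finite B" "card B = DIM(real^'k)" "pairwise orthogonal B"
    "\<And>b. b \<in> B \<Longrightarrow> norm b = 1" "\<And>b. b \<in> B \<Longrightarrow> \<exists>c. M *v b = c *\<^sub>R b"
    using self_adjoint_orthonormal_eigenbasis[OF lin sym] by metis
  have "card (UNIV :: 'k set) = card B"
    using B(2) by simp
  then obtain e where e: "bij_betw e (UNIV :: 'k set) B"
    using B(1) by (meson finite finite_same_card_bij)
  then have eB: "e j \<in> B" and inj: "e i = e j \<longleftrightarrow> i = j" for i j
    by (auto simp: bij_betw_def inj_eq)
  define U :: "real^'k^'k" where "U = (\<chi> i j. e j $ i)"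
  obtain g where g: "\<And>j. M *v e j = g j *\<^sub>R e j"
    using B(5)[OF eB] by metis
  have col: "column j U = e j" for j
    by (simp add: column_def U_def)
  have orth: "orthogonal_matrix U"
    unfolding orthogonal_matrix_orthonormal_columns col
    using B(3,4) eB inj by (auto simp: pairwise_def)
  have "M ** U = U ** (\<chi> i j. if i = j then g i else 0)"
    using g by (simp add: vec_eq_iff matrix_matrix_mult_def U_def matrix_vector_mult_def if_distrib
        cong: if_cong)
  then have "M ** U ** transpose U = spectral_matrix U g"
    by (simp add: spectral_matrix_def)
  then have "M = spectral_matrix U g"
    using orth by (simp add: orthogonal_matrix_def matrix_mul_assoc[symmetric])
  with orth show thesis
    by (rule that)
qed

lemma orthogonal_matrix_mult_cancel:
  assumes "orthogonal_matrix U"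
  shows "transpose U ** (U ** M) = M"
  using assms by (simp add: orthogonal_matrix_def matrix_mul_assoc)

lemma spectral_matrix_mult:
  assumes "orthogonal_matrix U"
  shows "spectral_matrix U g ** spectral_matrix U h = spectral_matrix U (\<lambda>j. g j * h j)"
proof -
  have "(\<chi> i j. if i = j then g i else 0) ** (\<chi> i j. if i = j then h i else 0) =
      (\<chi> i j. if i = j then g i * h i else 0)"
    by (simp add: vec_eq_iff matrix_matrix_mult_def mult_delta_left mult_delta_right)
  then have "U ** ((\<chi> i j. if i = j then g i else 0) ** ((\<chi> i j. if i = j then h i else 0) **
      transpose U)) = spectral_matrix U (\<lambda>j. g j * h j)"
    by (simp add: spectral_matrix_def matrix_mul_assoc)
  then show ?thesis
    unfolding spectral_matrix_def matrix_mul_assoc[symmetric]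
      orthogonal_matrix_mult_cancel[OF assms] .
qed

lemma spectral_matrix_const:
  assumes "orthogonal_matrix U"
  shows "spectral_matrix U (\<lambda>_. c) = mat c"
proof -
  have "(\<Sum>k\<in>UNIV. U $ i $ k * U $ j $ k) = (if i = j then 1 else 0)" for i j
    using assms
    by (simp add: orthogonal_matrix_def matrix_matrix_mult_def transpose_def vec_eq_iff mat_def)
  then show ?thesis
    by (simp add: vec_eq_iff spectral_matrix_nth mat_def mult.assoc flip: sum_distrib_left)
qed

lemma spectral_matrix_diff:
  "spectral_matrix U g - spectral_matrix U h = spectral_matrix U (\<lambda>j. g j - h j)"
  by (simp add: vec_eq_iff spectral_matrix_nth sum_subtractf left_diff_distrib)

lemma transpose_spectral_matrix [simp]: "transpose (spectral_matrix U g) = spectral_matrix U g"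
  by (simp add: vec_eq_iff spectral_matrix_nth transpose_def mult_ac)

lemma quadratic_form_spectral_matrix:
  "v \<bullet> (spectral_matrix U g *v v) = (\<Sum>j\<in>UNIV. g j * ((transpose U *v v) $ j)\<^sup>2)"
proof -
  have "v \<bullet> (spectral_matrix U g *v v) =
      (\<Sum>i\<in>UNIV. \<Sum>k\<in>UNIV. \<Sum>j\<in>UNIV. g j * (U $ i $ j * v $ i) * (U $ k $ j * v $ k))"
    by (simp add: inner_vec_def matrix_vector_mult_def spectral_matrix_nth sum_distrib_left
        sum_distrib_right mult_ac)
  also have "\<dots> = (\<Sum>i\<in>UNIV. \<Sum>j\<in>UNIV. \<Sum>k\<in>UNIV. g j * (U $ i $ j * v $ i) * (U $ k $ j * v $ k))"
    by (intro sum.cong refl sum.swap)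
  also have "\<dots> = (\<Sum>j\<in>UNIV. \<Sum>i\<in>UNIV. \<Sum>k\<in>UNIV. g j * (U $ i $ j * v $ i) * (U $ k $ j * v $ k))"
    by (rule sum.swap)
  also have "\<dots> = (\<Sum>j\<in>UNIV. g j * ((transpose U *v v) $ j)\<^sup>2)"
    by (simp add: matrix_vector_mult_def transpose_def power2_eq_square sum_product
        del: transpose_matrix_vector) (simp add: sum_distrib_left mult.assoc)
  finally show ?thesis .
qed

lemma quadratic_form_basis_vector:
  assumes "orthogonal_matrix U"
  shows "column j U \<bullet> (spectral_matrix U g *v column j U) = g j"
proof -
  have "(transpose U *v column j U) $ k = (if k = j then 1 else 0)" for k
    using assms
    by (simp add: orthogonal_matrix_def matrix_matrix_mult_def transpose_def vec_eq_iff mat_def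
        matrix_vector_mult_def column_def)
  then show ?thesis
    by (simp add: quadratic_form_spectral_matrix power2_eq_square mult_delta_left mult_delta_right
        del: transpose_matrix_vector)
qed

lemma column_orthogonal_matrix_nonzero:
  assumes "orthogonal_matrix (U :: real^'k^'k)"
  shows "column j U \<noteq> 0"
  using assms by (metis norm_zero orthogonal_matrix_orthonormal_columns zero_neq_one)

lemma pd_spectral_matrix_iff:
  assumes "orthogonal_matrix U"
  shows "pd_matrix (spectral_matrix U g) \<longleftrightarrow> (\<forall>j. 0 < g j)"
proof
  assume "pd_matrix (spectral_matrix U g)"
  then show "\<forall>j. 0 < g j"
    using quadratic_form_basis_vector[OF assms] column_orthogonal_matrix_nonzero[OF assms]
    by (metis pd_matrix_def)
next
  assume g: "\<forall>j. 0 < g j"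
  have "0 < (\<Sum>j\<in>UNIV. g j * ((transpose U *v x) $ j)\<^sup>2)" if "x \<noteq> 0" for x
  proof -
    have "U *v (transpose U *v x) = x"
      using assms by (simp add: matrix_vector_mul_assoc orthogonal_matrix_def del: transpose_matrix_vector)
    with that have "transpose U *v x \<noteq> 0"
      by auto
    then obtain j where "(transpose U *v x) $ j \<noteq> 0"
      by (auto simp: vec_eq_iff)
    with g show ?thesis
      by (intro sum_pos2[of _ j]) (auto simp: less_imp_le)
  qed
  then show "pd_matrix (spectral_matrix U g)"
    by (simp add: pd_matrix_def quadratic_form_spectral_matrix del: transpose_matrix_vector)
qed

lemma psd_spectral_matrix_nonneg:
  assumes "orthogonal_matrix U" "psd_matrix (spectral_matrix U g)"
  shows "0 \<le> g j"
  using assms quadratic_form_basis_vector[OF assms(1)] by (metis psd_matrix_def)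

lemma matrix_inv_eqI:
  fixes M :: "real^'k^'k"
  assumes "M ** N = mat 1"
  shows "matrix_inv M = N"
proof -
  have inv: "N ** M = mat 1"
    using assms by (simp add: matrix_left_right_inverse)
  have "\<exists>M'. M ** M' = mat 1 \<and> M' ** M = mat 1"
    using assms inv by blast
  then have minv: "M ** matrix_inv M = mat 1 \<and> matrix_inv M ** M = mat 1"
    unfolding matrix_inv_def by (rule someI_ex)
  have "matrix_inv M = N ** (M ** matrix_inv M)"
    using inv by (metis matrix_mul_assoc matrix_mul_lid)
  also have "\<dots> = N"
    using minv by simp
  finally show ?thesis .
qed

lemma matrix_inv_spectral_matrix:
  assumes "orthogonal_matrix U" "\<And>j. g j \<noteq> 0"
  shows "matrix_inv (spectral_matrix U g) = spectral_matrix U (\<lambda>j. 1 / g j)"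
  using assms by (intro matrix_inv_eqI) (simp add: spectral_matrix_mult spectral_matrix_const)

lemma det_spectral_matrix:
  assumes "orthogonal_matrix U"
  shows "det (spectral_matrix U g) = prod g UNIV"
proof -
  have "det U * det (transpose U) = 1"
    using assms by (metis det_I det_mul orthogonal_matrix_def)
  then show ?thesis
    by (simp add: spectral_matrix_def det_mul det_diagonal)
qed

lemma trace_mult_spectral_matrix:
  "trace (S ** spectral_matrix U g) = (\<Sum>j\<in>UNIV. (column j U \<bullet> (S *v column j U)) * g j)"
proof -
  have "trace (S ** spectral_matrix U g) =
      (\<Sum>i\<in>UNIV. \<Sum>k\<in>UNIV. \<Sum>j\<in>UNIV. U $ i $ j * S $ i $ k * U $ k $ j * g j)"
    by (simp add: trace_def matrix_matrix_mult_def spectral_matrix_nth sum_distrib_left mult_ac)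
  also have "\<dots> = (\<Sum>i\<in>UNIV. \<Sum>j\<in>UNIV. \<Sum>k\<in>UNIV. U $ i $ j * S $ i $ k * U $ k $ j * g j)"
    by (intro sum.cong refl sum.swap)
  also have "\<dots> = (\<Sum>j\<in>UNIV. \<Sum>i\<in>UNIV. \<Sum>k\<in>UNIV. U $ i $ j * S $ i $ k * U $ k $ j * g j)"
    by (rule sum.swap)
  also have "\<dots> = (\<Sum>j\<in>UNIV. (column j U \<bullet> (S *v column j U)) * g j)"
    by (simp add: inner_vec_def matrix_vector_mult_def column_def sum_distrib_left
        sum_distrib_right mult.assoc cong: sum.cong_simp)
  finally show ?thesis .
qed

section \<open>Positive semidefiniteness of the cost matrix\<close>

lemma psd_matrix_add:
  assumes "psd_matrix M" "psd_matrix N"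
  shows "psd_matrix (M + N)"
  using assms
  by (auto simp: psd_matrix_def transpose_def vec_eq_iff matrix_vector_mult_add_rdistrib inner_add_right)

lemma quadratic_form_congruence:
  fixes M :: "real^'k^'k" and N :: "real^'j^'k"
  shows "x \<bullet> ((transpose N ** M ** N) *v x) = (N *v x) \<bullet> (M *v (N *v x))"
proof -
  have "x \<bullet> ((transpose N ** M ** N) *v x) = ((M *v (N *v x)) v* N) \<bullet> x"
    by (simp add: inner_commute flip: matrix_vector_mul_assoc)
  also have "\<dots> = (N *v x) \<bullet> (M *v (N *v x))"
    by (simp only: dot_lmul_matrix inner_commute[of "N *v x" "M *v (N *v x)"])
  finally show ?thesis .
qed

lemma psd_matrix_congruence:
  fixes M :: "real^'k^'k" and N :: "real^'j^'k"
  assumes "psd_matrix M"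
  shows "psd_matrix (transpose N ** M ** N)"
  using assms
  by (simp add: psd_matrix_def quadratic_form_congruence matrix_transpose_mul matrix_mul_assoc)

lemma pd_matrix_imp_psd_matrix: "pd_matrix M \<Longrightarrow> psd_matrix M"
  by (auto simp: pd_matrix_def psd_matrix_def) (metis inner_zero_left less_imp_le order_refl)

text \<open>
  The quadratic form of a block diagonal matrix is the sum of the quadratic forms of its blocks,
  evaluated at the corresponding parts of the vector.
\<close>
lemma psd_matrix_blkdiag:
  assumes "\<And>i. psd_matrix (M i)"
  shows "psd_matrix (blkdiag M)"
proof -
  define part where "part x i = (\<chi> a. x $ (i, a))" for x :: "real^('a \<times> 'b)" and i
  have "(blkdiag M *v x) $ (i, a) = (M i *v part x i) $ a" for x i a
    by (simp add: matrix_vector_mult_def blkdiag_def part_def sum.cartesian_product'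
        flip: UNIV_Times_UNIV) (subst sum.swap, simp add: mult_delta_left)
  then have "x \<bullet> (blkdiag M *v x) = (\<Sum>i\<in>UNIV. part x i \<bullet> (M i *v part x i))" for x
    by (simp add: inner_vec_def part_def sum.cartesian_product' flip: UNIV_Times_UNIV)
  moreover have "M i $ a $ b = M i $ b $ a" for i a b
    using assms[of i] by (simp add: psd_matrix_def transpose_def vec_eq_iff)
  ultimately show ?thesis
    using assms by (auto simp: psd_matrix_def blkdiag_def transpose_def vec_eq_iff intro!: sum_nonneg)
qed

lemma psd_matrix_Xi:
  assumes "\<And>k. psd_matrix (Q k)" "\<And>k. psd_matrix (R k)"
  shows "psd_matrix (Xi A B D Q R L)"
proof -
  have "psd_matrix (case_option 0 Q k)" for k
    using assms(1) by (cases k) (auto simp: psd_matrix_def transpose_def vec_eq_iff)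
  then show ?thesis
    unfolding Xi_def Let_def
    by (intro psd_matrix_congruence psd_matrix_add psd_matrix_blkdiag assms)
qed

section \<open>Second moments of the multivariate normal distribution\<close>

lemma nn_integral_lborel_translation:
  fixes c :: "'a::euclidean_space"
  assumes "h \<in> borel_measurable borel"
  shows "(\<integral>\<^sup>+x. h (c + x) \<partial>lborel) = (\<integral>\<^sup>+x. h x \<partial>lborel)"
proof -
  have "(\<integral>\<^sup>+x. h x \<partial>lborel) = (\<integral>\<^sup>+x. h x \<partial>distr lborel borel ((+) c))"
    by (simp only: lborel_distr_plus)
  also have "\<dots> = (\<integral>\<^sup>+x. h (c + x) \<partial>lborel)"
    using assms by (intro nn_integral_distr) auto
  finally show ?thesis ..
qed

text \<open>
  Let $\mu$ be the image of Lebesgue measure $\lambda$ under \<open>f\<close>, and $\beta$, $\alpha$ the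
  indicators of the unit ball and of $A$. Both measures are invariant under translations, so two
  translations and two exchanges of the order of integration transform
  $$\lambda(\mathrm{ball})\,\mu(A) = \int\int \beta(y)\,\alpha(f x)\,dx\,dy
    \quad\mbox{into}\quad \int\int \beta(y - f x)\,\alpha(y)\,dx\,dy.$$
  As \<open>f\<close> is an isometry, the inner integral is $\alpha(y)$ times the volume of the unit ball
  around $f^{-1}(y)$, and the result is $\lambda(\mathrm{ball})\,\lambda(A)$. This is the usual uniqueness proof for
  Haar measure, with the ball fixing the normalization.
\<close>
lemma lborel_distr_orthogonal_transformation:
  fixes f :: "'a::euclidean_space \<Rightarrow> 'a"
  assumes f: "orthogonal_transformation f"
  shows "distr lborel borel f = lborel"
proof (rule measure_eqI)
  have lin: "linear f"
    using f by (simp add: orthogonal_transformation_linear)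
  have [measurable]: "f \<in> borel_measurable borel"
    using lin by (intro borel_measurable_continuous_onI linear_continuous_on)
      (simp add: linear_conv_bounded_linear)
  define g where "g = inv f"
  have fg: "f (g y) = y" for y
    using orthogonal_transformation_surj[OF f] by (simp add: g_def surj_f_inv_f)
  define v where "v = emeasure lborel (ball (0::'a) 1)"
  have ball: "emeasure lborel (ball c 1) = v" for c :: 'a
    by (simp add: v_def emeasure_ball)
  have v: "v \<noteq> 0" "v \<noteq> \<infinity>"
    using unit_ball_vol_pos[of "DIM('a)"] by (auto simp: v_def emeasure_ball less_le)
  fix A assume "A \<in> sets (distr lborel borel f)"
  then have [measurable]: "A \<in> sets borel"
    by simp
  define \<beta> where "\<beta> = (indicator (ball (0::'a) 1) :: 'a \<Rightarrow> ennreal)"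
  define \<alpha> where "\<alpha> = (indicator A :: 'a \<Rightarrow> ennreal)"
  have [measurable]: "\<alpha> \<in> borel_measurable borel" "\<beta> \<in> borel_measurable borel"
    unfolding \<alpha>_def \<beta>_def by (auto intro!: borel_measurable_indicator)
  have "v * emeasure (distr lborel borel f) A = (\<integral>\<^sup>+y. \<beta> y \<partial>lborel) * (\<integral>\<^sup>+x. \<alpha> (f x) \<partial>lborel)"
  proof -
    have "emeasure (distr lborel borel f) A = (\<integral>\<^sup>+x. \<alpha> x \<partial>distr lborel borel f)"
      by (simp add: \<alpha>_def)
    also have "\<dots> = (\<integral>\<^sup>+x. \<alpha> (f x) \<partial>lborel)"
      by (rule nn_integral_distr) measurable
    finally show ?thesis
      by (simp add: v_def \<beta>_def)
  qed
  also have "\<dots> = (\<integral>\<^sup>+y. \<beta> y * (\<integral>\<^sup>+x. \<alpha> (f x) \<partial>lborel) \<partial>lborel)"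
    by (rule nn_integral_multc[symmetric]) measurable
  also have "\<dots> = (\<integral>\<^sup>+y. (\<integral>\<^sup>+x. \<beta> y * \<alpha> (y + f x) \<partial>lborel) \<partial>lborel)"
  proof (rule nn_integral_cong)
    fix y :: 'a
    have "(\<integral>\<^sup>+x. \<alpha> (f x) \<partial>lborel) = (\<integral>\<^sup>+x. \<alpha> (f (g y + x)) \<partial>lborel)"
      by (rule nn_integral_lborel_translation[symmetric]) measurable
    then show "\<beta> y * (\<integral>\<^sup>+x. \<alpha> (f x) \<partial>lborel) = (\<integral>\<^sup>+x. \<beta> y * \<alpha> (y + f x) \<partial>lborel)"
      using lin by (simp add: linear_add fg nn_integral_cmult)
  qed
  also have "\<dots> = (\<integral>\<^sup>+x. (\<integral>\<^sup>+y. \<beta> y * \<alpha> (y + f x) \<partial>lborel) \<partial>lborel)"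
    by (rule lborel_pair.Fubini') measurable
  also have "\<dots> = (\<integral>\<^sup>+x. (\<integral>\<^sup>+y. \<beta> (y - f x) * \<alpha> y \<partial>lborel) \<partial>lborel)"
  proof (rule nn_integral_cong)
    fix x :: 'a
    show "(\<integral>\<^sup>+y. \<beta> y * \<alpha> (y + f x) \<partial>lborel) = (\<integral>\<^sup>+y. \<beta> (y - f x) * \<alpha> y \<partial>lborel)"
      using nn_integral_lborel_translation[of "\<lambda>y. \<beta> (y - f x) * \<alpha> y" "f x"]
      by (simp add: add.commute)
  qed
  also have "\<dots> = (\<integral>\<^sup>+y. (\<integral>\<^sup>+x. \<beta> (y - f x) * \<alpha> y \<partial>lborel) \<partial>lborel)"
    by (rule lborel_pair.Fubini') measurable
  also have "\<dots> = (\<integral>\<^sup>+y. v * \<alpha> y \<partial>lborel)"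
  proof (rule nn_integral_cong)
    fix y
    have "norm (f x - y) = norm (g y - x)" for x
      using orthogonal_transformation_norm[OF f, of "g y - x"] lin
      by (simp add: linear_diff fg norm_minus_commute)
    then have "\<beta> (y - f x) = indicator (ball (g y) 1) x" for x
      by (simp add: \<beta>_def indicator_def dist_norm)
    moreover have "(indicator (ball (g y) 1) :: 'a \<Rightarrow> ennreal) \<in> borel_measurable lborel"
      by (auto intro!: borel_measurable_indicator)
    ultimately show "(\<integral>\<^sup>+x. \<beta> (y - f x) * \<alpha> y \<partial>lborel) = v * \<alpha> y"
      by (simp only: nn_integral_multc nn_integral_indicator) (simp add: ball)
  qed
  also have "\<dots> = v * emeasure lborel A"
    by (simp add: nn_integral_cmult \<alpha>_def)
  finally show "emeasure (distr lborel borel f) A = emeasure lborel A"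
    using v by (simp add: ennreal_mult_cancel_left)
qed simp

lemma lborel_product_integral_vec:
  fixes h :: "'k::finite \<Rightarrow> real \<Rightarrow> real"
  assumes h: "\<And>k. integrable lborel (h k)"
  shows "integrable lborel (\<lambda>y::real^'k. \<Prod>k\<in>UNIV. h k (y $ k))"
    and "(\<integral>y. (\<Prod>k\<in>UNIV. h k (y $ k)) \<partial>(lborel :: (real^'k) measure)) = (\<Prod>k\<in>UNIV. \<integral>t. h k t \<partial>lborel)"
proof -
  interpret product_sigma_finite "\<lambda>_::real^'k. lborel :: real measure"
    by standard
  let ?e = "\<lambda>k::'k. axis k (1::real)"
  define h' where "h' b = h (inv ?e b)" for b
  have bij: "bij_betw ?e UNIV Basis"
    by (auto simp: bij_betw_def inj_on_def axis_eq_axis Basis_vec_def)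
  have inv: "inv ?e (?e k) = k" for k
    by (rule inv_f_f) (auto simp: inj_on_def axis_eq_axis)
  have [measurable]: "h' b \<in> borel_measurable borel" for b
    using h borel_measurable_integrable by (auto simp: h'_def)
  have reindex: "(\<Prod>b\<in>Basis. F b) = (\<Prod>k\<in>UNIV. F (?e k))" for F :: "real^'k \<Rightarrow> real"
    using bij by (rule prod.reindex_bij_betw[symmetric])
  have eq: "(\<Prod>k\<in>UNIV. h k (y $ k)) = (\<Prod>b\<in>Basis. h' b (y \<bullet> b))" for y :: "real^'k"
    by (simp add: reindex h'_def inv cart_eq_inner_axis)
  have coord: "(\<Sum>b\<in>Basis. x b *\<^sub>R b) \<bullet> c = x c" if "c \<in> Basis" for x and c :: "real^'k"
    using that by simp
  have int: "integrable lborel (h' b)" for b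
    using h by (simp add: h'_def)
  have "integrable (\<Pi>\<^sub>M b\<in>Basis. lborel) (\<lambda>x. \<Prod>b\<in>Basis. h' b (x b))"
    using int by (intro product_integrable_prod) auto
  then show "integrable lborel (\<lambda>y::real^'k. \<Prod>k\<in>UNIV. h k (y $ k))"
    unfolding eq by (subst lborel_eq) (simp add: integrable_distr_eq coord cong: prod.cong)
  have "(\<integral>y. (\<Prod>b\<in>Basis. h' b (y \<bullet> b)) \<partial>(lborel :: (real^'k) measure)) =
      (\<integral>x. (\<Prod>b\<in>Basis. h' b (x b)) \<partial>(\<Pi>\<^sub>M b\<in>Basis. lborel))"
    by (subst lborel_eq) (simp add: integral_distr coord cong: prod.cong)
  also have "\<dots> = (\<Prod>b\<in>Basis. integral\<^sup>L lborel (h' b))"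
    using int by (intro product_integral_prod) auto
  finally show "(\<integral>y. (\<Prod>k\<in>UNIV. h k (y $ k)) \<partial>(lborel :: (real^'k) measure)) = (\<Prod>k\<in>UNIV. \<integral>t. h k t \<partial>lborel)"
    by (simp add: eq reindex h'_def inv)
qed

definition product_normal_density :: "('k::finite \<Rightarrow> real) \<Rightarrow> real^'k \<Rightarrow> real" where
  "product_normal_density s y = (\<Prod>k\<in>UNIV. normal_density 0 (sqrt (s k)) (y $ k))"

lemma product_normal_density_nonneg: "0 \<le> product_normal_density s y"
  by (simp add: product_normal_density_def prod_nonneg)

lemma product_normal_density_measurable [measurable]:
  "product_normal_density s \<in> borel_measurable borel"
  unfolding product_normal_density_def by measurable

lemma product_normal_mass:
  fixes s :: "'k::finite \<Rightarrow> real"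
  assumes "\<And>k. 0 < s k"
  shows "integrable lborel (product_normal_density s)"
    and "(\<integral>y. product_normal_density s y \<partial>lborel) = 1"
  using lborel_product_integral_vec[of "\<lambda>k. normal_density 0 (sqrt (s k))"] assms
  by (simp_all add: product_normal_density_def[abs_def])

lemma product_normal_second_moment:
  fixes s :: "'k::finite \<Rightarrow> real"
  assumes s: "\<And>k. 0 < s k"
  shows "integrable lborel (\<lambda>y. product_normal_density s y * (y $ i * y $ j))"
    and "(\<integral>y. product_normal_density s y * (y $ i * y $ j) \<partial>lborel) = (if i = j then s i else 0)"
proof -
  \<comment> \<open>the factors $y_i$ and $y_j$ are absorbed into the densities of their own coordinates\<close>
  define h where "h k t = normal_density 0 (sqrt (s k)) t *
      ((if k = i then t else 1) * (if k = j then t else 1))" for k t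
  have prod: "product_normal_density s y * (y $ i * y $ j) = (\<Prod>k\<in>UNIV. h k (y $ k))" for y
    by (simp add: h_def product_normal_density_def prod.distrib)
  have moments: "has_bochner_integral lborel (h k)
      (if k = i \<and> k = j then s k else if k = i \<or> k = j then 0 else 1)" for k
    using normal_moment_nz_1[of "sqrt (s k)" 0] normal_moment_even[of "sqrt (s k)" 0 1] s[of k]
    by (auto simp: h_def[abs_def] has_bochner_integral_iff power2_eq_square fact_numeral)
  then have int: "integrable lborel (h k)" for k
    by (simp add: has_bochner_integral_iff)
  show "integrable lborel (\<lambda>y. product_normal_density s y * (y $ i * y $ j))"
    unfolding prod by (intro lborel_product_integral_vec int)
  have "(\<integral>y. product_normal_density s y * (y $ i * y $ j) \<partial>lborel) =
      (\<Prod>k\<in>UNIV. if k = i \<and> k = j then s k else if k = i \<or> k = j then 0 else 1)"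
    unfolding prod lborel_product_integral_vec(2)[OF int]
    using moments by (simp add: has_bochner_integral_iff)
  also have "\<dots> = (if i = j then s i else 0)"
  proof (cases "i = j")
    case True
    then have "(\<Prod>k\<in>UNIV. if k = i \<and> k = j then s k else if k = i \<or> k = j then 0 else 1) =
        (\<Prod>k\<in>UNIV. if k = i then s k else 1)"
      by (intro prod.cong) auto
    with True show ?thesis by simp
  next
    case False
    then show ?thesis by (auto intro!: prod_zero)
  qed
  finally show "(\<integral>y. product_normal_density s y * (y $ i * y $ j) \<partial>lborel) =
      (if i = j then s i else 0)" .
qed

lemma orthogonal_transformation_orthogonal_matrix:
  assumes "orthogonal_matrix (U :: real^'k^'k)"
  shows "orthogonal_transformation ((*v) U)"
  using assms by (simp add: orthogonal_transformation_matrix)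

lemma matrix_vector_mult_measurable [measurable]:
  "(*v) (M :: real^'k^'j) \<in> borel_measurable borel"
  by (intro borel_measurable_continuous_onI) (simp add: matrix_vector_mult_linear_continuous_on)

lemma real_sqrt_prod: "sqrt (prod f A) = (\<Prod>k\<in>A. sqrt (f k))"
  by (induction A rule: infinite_finite_induct) (auto simp: real_sqrt_mult)

text \<open>
  In the coordinates $y = U^T x$ of an eigenbasis of the covariance matrix the density factorizes
  into one-dimensional normal densities, and Lebesgue measure is unchanged by the rotation.
\<close>
lemma centered_normal_spectral_matrix:
  assumes U: "orthogonal_matrix U" and s: "\<And>k. 0 < s k"
  shows "centered_normal (spectral_matrix U s) =
    distr (density lborel (product_normal_density s)) borel ((*v) U)"
proof -
  let ?p = "\<lambda>x. exp (- (x \<bullet> (matrix_inv (spectral_matrix U s) *v x)) / 2) /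
      sqrt ((2 * pi) ^ CARD('a) * det (spectral_matrix U s))"
  have s0: "s k \<noteq> 0" for k
    using s[of k] by simp
  have p: "?p (U *v y) = product_normal_density s y" for y
  proof -
    have UU: "transpose U *v (U *v y) = y"
      using U by (simp add: matrix_vector_mul_assoc orthogonal_matrix_def del: transpose_matrix_vector)
    have "?p (U *v y) = exp (\<Sum>k\<in>UNIV. - (y $ k)\<^sup>2 / (2 * s k)) / sqrt (\<Prod>k\<in>UNIV. 2 * pi * s k)"
      by (simp add: matrix_inv_spectral_matrix[OF U s0] quadratic_form_spectral_matrix UU
          det_spectral_matrix[OF U] prod.distrib sum_divide_distrib sum_negf
          del: transpose_matrix_vector) (simp add: mult.commute)
    also have "\<dots> = product_normal_density s y"
      using s by (simp add: product_normal_density_def normal_density_def exp_sum less_imp_le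
          prod_dividef prod.distrib flip: real_sqrt_prod)
    finally show ?thesis .
  qed
  have pm: "?p \<in> borel_measurable borel"
    by measurable
  have "centered_normal (spectral_matrix U s) = density lborel (\<lambda>x. ennreal (?p x))"
    by (simp add: centered_normal_def)
  also have "\<dots> = density (distr lborel borel ((*v) U)) (\<lambda>x. ennreal (?p x))"
    by (simp only: lborel_distr_orthogonal_transformation[OF orthogonal_transformation_orthogonal_matrix[OF U]])
  also have "\<dots> = distr (density lborel (\<lambda>y. ennreal (?p (U *v y)))) borel ((*v) U)"
    using pm by (intro density_distr) measurable
  finally show ?thesis
    unfolding p .
qed

text \<open>
  In eigencoordinates of \<open>S\<close> the components are uncorrelated with the eigenvalues as variances, so
  only the diagonal entries of $U^T M U$ contribute to the expectation of the quadratic form.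
\<close>
theorem centered_normal_moments:
  fixes S :: "real^'k^'k"
  assumes "pd_matrix S"
  shows "prob_space (centered_normal S)" and "sets (centered_normal S) = sets borel"
    and "integrable (centered_normal S) (\<lambda>x. x \<bullet> (M *v x))"
    and "(\<integral>x. x \<bullet> (M *v x) \<partial>centered_normal S) = trace (S ** M)"
proof -
  obtain U s where U: "orthogonal_matrix U" and S: "S = spectral_matrix U s"
    using symmetric_matrix_diagonalization[of S] assms by (auto simp: pd_matrix_def)
  have s: "0 < s k" for k
    using assms U by (simp add: S pd_spectral_matrix_iff)
  let ?G = "density lborel (product_normal_density s)"
  have eq: "centered_normal S = distr ?G borel ((*v) U)"
    unfolding S by (rule centered_normal_spectral_matrix[OF U s])
  have "emeasure ?G (space ?G) = 1"
    using product_normal_mass[of s, OF s]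
    by (simp add: emeasure_density nn_integral_eq_integral product_normal_density_nonneg)
  then have "prob_space ?G"
    by (rule prob_spaceI)
  then show "prob_space (centered_normal S)"
    unfolding eq by (rule prob_space.prob_space_distr) simp
  show "sets (centered_normal S) = sets borel"
    by (simp add: eq)
  define c where "c i j = column i U \<bullet> (M *v column j U)" for i j
  have form: "(U *v y) \<bullet> (M *v (U *v y)) = (\<Sum>i\<in>UNIV. \<Sum>j\<in>UNIV. c i j * (y $ i * y $ j))" for y
  proof -
    have "U *v y = (\<Sum>i\<in>UNIV. y $ i *\<^sub>R column i U)"
      by (simp add: matrix_mult_sum scalar_mult_eq_scaleR)
    then show ?thesis
      by (simp add: c_def inner_sum_left inner_sum_right linear_sum[of "(*v) M"]
          matrix_vector_mult_scaleR sum_distrib_left mult_ac)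
        (subst sum.swap, simp add: mult.left_commute)
  qed
  have [measurable]: "(\<lambda>x. x \<bullet> (M *v x)) \<in> borel_measurable borel"
    by measurable
  have density_form: "product_normal_density s y * ((U *v y) \<bullet> (M *v (U *v y))) =
      (\<Sum>i\<in>UNIV. \<Sum>j\<in>UNIV. c i j * (product_normal_density s y * (y $ i * y $ j)))" for y
    by (simp add: form sum_distrib_left mult_ac)
  have int: "integrable lborel (\<lambda>y. c i j * (product_normal_density s y * (y $ i * y $ j)))" for i j
    using product_normal_second_moment[of s, OF s] by simp
  show "integrable (centered_normal S) (\<lambda>x. x \<bullet> (M *v x))"
    using int unfolding eq
    by (simp add: integrable_distr_eq integrable_density product_normal_density_nonneg density_form)
  have "(\<integral>x. x \<bullet> (M *v x) \<partial>centered_normal S) =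
      (\<integral>y. product_normal_density s y * ((U *v y) \<bullet> (M *v (U *v y))) \<partial>lborel)"
    unfolding eq by (simp add: integral_distr integral_density product_normal_density_nonneg)
  also have "\<dots> = (\<Sum>i\<in>UNIV. \<Sum>j\<in>UNIV. c i j * (if i = j then s i else 0))"
    unfolding density_form using int product_normal_second_moment[of s, OF s]
    by (simp add: Bochner_Integration.integral_sum)
  also have "\<dots> = trace (M ** S)"
    by (simp add: S trace_mult_spectral_matrix c_def mult_delta_right)
  finally show "(\<integral>x. x \<bullet> (M *v x) \<partial>centered_normal S) = trace (S ** M)"
    by (simp only: trace_mul_sym[of S M])
qed

section \<open>Couplings and the Wasserstein ball\<close>

lemma quadratic_form_integrable:
  fixes P :: "(real^'k) measure"
  assumes "P \<in> P2"
  shows "integrable P (\<lambda>x. x \<bullet> (M *v x))"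
proof (rule Bochner_Integration.integrable_bound)
  show "integrable P (\<lambda>x. onorm ((*v) M) * (norm x)\<^sup>2)"
    using assms by (simp add: P2_def)
  have "sets P = sets borel"
    using assms by (simp add: P2_def)
  then show "(\<lambda>x. x \<bullet> (M *v x)) \<in> borel_measurable P"
    by (subst measurable_cong_sets[OF _ refl]) measurable
  have "\<bar>x \<bullet> (M *v x)\<bar> \<le> onorm ((*v) M) * (norm x)\<^sup>2" for x
  proof -
    have "\<bar>x \<bullet> (M *v x)\<bar> \<le> norm x * norm (M *v x)"
      by (rule Cauchy_Schwarz_ineq2)
    also have "\<dots> \<le> norm x * (onorm ((*v) M) * norm x)"
      by (intro mult_left_mono onorm) (auto simp: matrix_vector_mul_bounded_linear)
    finally show ?thesis
      by (simp add: power2_eq_square mult_ac)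
  qed
  then show "AE x in P. norm (x \<bullet> (M *v x)) \<le> norm (onorm ((*v) M) * (norm x)\<^sup>2)"
    by (intro AE_I2) (metis abs_ge_self order_trans real_norm_def)
qed

lemma centered_normal_in_P2:
  assumes "pd_matrix S"
  shows "centered_normal S \<in> P2"
  using centered_normal_moments(1,2)[OF assms] centered_normal_moments(3)[OF assms, of "mat 1"]
  by (simp add: P2_def dot_square_norm)

text \<open>
  Independent coupling shows that the infimum defining the Wasserstein distance is over a nonempty
  set, which is what makes near-optimal couplings available.
\<close>
lemma product_measure_in_couplings:
  assumes "P \<in> P2" "Q \<in> P2"
  shows "P \<Otimes>\<^sub>M Q \<in> couplings P Q"
proof -
  interpret P: prob_space P using assms by (simp add: P2_def)
  interpret Q: prob_space Q using assms by (simp add: P2_def)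
  interpret PQ: pair_prob_space P Q ..
  have sets: "sets P = sets borel" "sets Q = sets borel"
    using assms by (simp_all add: P2_def)
  have "distr (P \<Otimes>\<^sub>M Q) borel fst = distr (P \<Otimes>\<^sub>M Q) P fst"
    by (rule distr_cong) (simp_all add: sets)
  moreover have "distr (P \<Otimes>\<^sub>M Q) borel snd = distr (P \<Otimes>\<^sub>M Q) Q snd"
    by (rule distr_cong) (simp_all add: sets)
  moreover have "distr (P \<Otimes>\<^sub>M Q) Q snd = Q"
  proof (rule measure_eqI)
    fix A assume A: "A \<in> sets (distr (P \<Otimes>\<^sub>M Q) Q snd)"
    have "snd -` A \<inter> space (P \<Otimes>\<^sub>M Q) = space P \<times> A"
      using A sets.sets_into_space[of A Q] by (auto simp: space_pair_measure)
    with A show "emeasure (distr (P \<Otimes>\<^sub>M Q) Q snd) A = emeasure Q A"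
      by (simp add: emeasure_distr Q.emeasure_pair_measure_Times P.emeasure_space_1)
  qed simp
  ultimately show ?thesis
    using Q.distr_pair_fst[of P] sets
    by (simp add: couplings_def PQ.prob_space_axioms cong: sets_pair_measure_cong)
qed

lemma wasserstein_ball_near_optimal_coupling:
  assumes "P \<in> P2" "Q \<in> wasserstein_ball P r" "0 < e"
  obtains \<pi> where "\<pi> \<in> couplings Q P" "(\<integral>z. (norm (fst z - snd z))\<^sup>2 \<partial>\<pi>) < r\<^sup>2 + e"
proof -
  let ?cost = "\<lambda>\<pi>. \<integral>z. (norm (fst z - snd z))\<^sup>2 \<partial>\<pi>"
  have Q: "Q \<in> P2" and "sqrt (INF \<pi>\<in>couplings Q P. ?cost \<pi>) \<le> r"
    using assms(2) by (simp_all add: wasserstein_ball_def wasserstein2_def)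
  then have "(INF \<pi>\<in>couplings Q P. ?cost \<pi>) \<le> r\<^sup>2"
    by (intro sqrt_le_D)
  then have "(INF \<pi>\<in>couplings Q P. ?cost \<pi>) < r\<^sup>2 + e"
    using assms(3) by simp
  moreover have "?cost ` couplings Q P \<noteq> {}"
    using product_measure_in_couplings[OF Q assms(1)] by auto
  ultimately show thesis
    using cInf_lessD[of "?cost ` couplings Q P"] that by blast
qed

lemma couplings_marginal_integrals:
  fixes f :: "'a::euclidean_space \<Rightarrow> real"
  assumes \<pi>: "\<pi> \<in> couplings Q P"
  shows "integrable Q f \<Longrightarrow> integrable \<pi> (\<lambda>z. f (fst z))"
    and "integrable P f \<Longrightarrow> integrable \<pi> (\<lambda>z. f (snd z))"
    and "integrable Q f \<Longrightarrow> (\<integral>z. f (fst z) \<partial>\<pi>) = (\<integral>x. f x \<partial>Q)"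
    and "integrable P f \<Longrightarrow> (\<integral>z. f (snd z) \<partial>\<pi>) = (\<integral>x. f x \<partial>P)"
proof -
  have sets: "sets \<pi> = sets (borel \<Otimes>\<^sub>M borel)" and
    marg: "distr \<pi> borel fst = Q" "distr \<pi> borel snd = P"
    using \<pi> by (simp_all add: couplings_def)
  have meas: "fst \<in> \<pi> \<rightarrow>\<^sub>M borel" "snd \<in> \<pi> \<rightarrow>\<^sub>M borel"
    by (simp_all add: measurable_cong_sets[OF sets refl])
  have bor: "f \<in> borel_measurable borel" if "integrable (distr \<pi> borel h) f" for h
    using borel_measurable_integrable[OF that] by simp
  show "integrable Q f \<Longrightarrow> integrable \<pi> (\<lambda>z. f (fst z))"
    using bor[of fst] integrable_distr[OF meas(1), of f] by (simp add: marg)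
  show "integrable P f \<Longrightarrow> integrable \<pi> (\<lambda>z. f (snd z))"
    using bor[of snd] integrable_distr[OF meas(2), of f] by (simp add: marg)
  show "(\<integral>z. f (fst z) \<partial>\<pi>) = (\<integral>x. f x \<partial>Q)" if "integrable Q f"
    using bor[of fst] integral_distr[OF meas(1), of f] that by (simp add: marg)
  show "(\<integral>z. f (snd z) \<partial>\<pi>) = (\<integral>x. f x \<partial>P)" if "integrable P f"
    using bor[of snd] integral_distr[OF meas(2), of f] that by (simp add: marg)
qed

lemma coupling_cost_integrable:
  assumes \<pi>: "\<pi> \<in> couplings Q P" and "Q \<in> P2" "P \<in> P2"
  shows "integrable \<pi> (\<lambda>z. (norm (fst z - snd z))\<^sup>2)"
proof (rule Bochner_Integration.integrable_bound)
  show "integrable \<pi> (\<lambda>z. 2 * (norm (fst z))\<^sup>2 + 2 * (norm (snd z))\<^sup>2)"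
    using couplings_marginal_integrals(1,2)[OF \<pi>, of "\<lambda>x. (norm x)\<^sup>2"] assms
    by (simp add: P2_def)
  have sets: "sets \<pi> = sets (borel \<Otimes>\<^sub>M borel)"
    using \<pi> by (simp add: couplings_def)
  show "(\<lambda>z. (norm (fst z - snd z))\<^sup>2) \<in> borel_measurable \<pi>"
    by (subst measurable_cong_sets[OF sets refl]) measurable
  have "(norm (a - b))\<^sup>2 \<le> 2 * (norm a)\<^sup>2 + 2 * (norm b)\<^sup>2" for a b :: 'a
  proof -
    have "0 \<le> (norm (a + b))\<^sup>2"
      by simp
    then show ?thesis
      by (simp add: power2_norm_eq_inner inner_add_left inner_add_right inner_diff_left
          inner_diff_right inner_commute)
  qed
  then show "AE z in \<pi>. norm ((norm (fst z - snd z))\<^sup>2) \<le>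
      norm (2 * (norm (fst z))\<^sup>2 + 2 * (norm (snd z))\<^sup>2)"
    by (intro AE_I2) simp
qed

text \<open>
  In the eigencoordinates $a = U^T w$ and $b = U^T v$ the difference of the two sides is the sum of
  the squares $(l - x_j)\,(a_j - l\,b_j/(l - x_j))^2$.
\<close>
lemma transport_penalty_bound:
  fixes U :: "real^'k^'k"
  assumes U: "orthogonal_matrix U" and l: "\<And>j. x j < l"
  shows "w \<bullet> (spectral_matrix U x *v w) \<le>
    l * (norm (w - v))\<^sup>2 + v \<bullet> (spectral_matrix U (\<lambda>j. l * x j / (l - x j)) *v v)"
proof -
  define a where "a j = (transpose U *v w) $ j" for j
  define b where "b j = (transpose U *v v) $ j" for j
  have "(norm (w - v))\<^sup>2 = (w - v) \<bullet> (spectral_matrix U (\<lambda>_. 1) *v (w - v))"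
    by (simp add: spectral_matrix_const[OF U] power2_norm_eq_inner)
  then have norm: "(norm (w - v))\<^sup>2 = (\<Sum>j\<in>UNIV. (a j - b j)\<^sup>2)"
    unfolding quadratic_form_spectral_matrix
    by (simp add: a_def b_def matrix_vector_mult_diff_distrib
        del: transpose_matrix_vector)
  have "x j * (a j)\<^sup>2 \<le> l * (a j - b j)\<^sup>2 + l * x j / (l - x j) * (b j)\<^sup>2" for j
  proof -
    define c where "c = b j / (l - x j)"
    have b: "b j = (l - x j) * c"
      using l[of j] by (simp add: c_def)
    have "0 \<le> (l - x j) * (a j - l * c)\<^sup>2"
      using l[of j] by simp
    also have "\<dots> = l * (a j - b j)\<^sup>2 + l * x j * c * b j - x j * (a j)\<^sup>2"
      unfolding b by (simp add: power2_eq_square algebra_simps)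
    also have "l * x j * c * b j = l * x j / (l - x j) * (b j)\<^sup>2"
      by (simp add: c_def power2_eq_square)
    finally show ?thesis by simp
  qed
  then have "(\<Sum>j\<in>UNIV. x j * (a j)\<^sup>2) \<le>
      (\<Sum>j\<in>UNIV. l * (a j - b j)\<^sup>2 + l * x j / (l - x j) * (b j)\<^sup>2)"
    by (rule sum_mono)
  then show ?thesis
    by (simp add: quadratic_form_spectral_matrix norm sum.distrib sum_distrib_left a_def b_def
        del: transpose_matrix_vector)
qed

text \<open>
  Integrating the pointwise bound over a coupling of \<open>Q\<close> with the centre \<open>P\<close> replaces the
  penalty by $l$ times the transport cost. The infimum over couplings is approached up to
  $e/(l+1)$, so that multiplication by $l$ keeps the error below $e$ even when $l = 0$.
\<close>
lemma wasserstein_weak_duality: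
  fixes U :: "real^'k^'k"
  assumes U: "orthogonal_matrix U" and l: "0 \<le> l" "\<And>j. x j < l"
    and P: "P \<in> P2" and Q: "Q \<in> wasserstein_ball P r"
  shows "(\<integral>w. w \<bullet> (spectral_matrix U x *v w) \<partial>Q) \<le>
    l * r\<^sup>2 + (\<integral>v. v \<bullet> (spectral_matrix U (\<lambda>j. l * x j / (l - x j)) *v v) \<partial>P)"
proof (rule field_le_epsilon)
  fix e :: real assume "0 < e"
  let ?q = "\<lambda>w. w \<bullet> (spectral_matrix U x *v w)"
  let ?p = "\<lambda>v. v \<bullet> (spectral_matrix U (\<lambda>j. l * x j / (l - x j)) *v v)"
  have Q2: "Q \<in> P2"
    using Q by (simp add: wasserstein_ball_def)
  have "0 < e / (l + 1)"
    using \<open>0 < e\<close> l(1) by simp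
  then obtain \<pi> where \<pi>: "\<pi> \<in> couplings Q P"
    and cost: "(\<integral>z. (norm (fst z - snd z))\<^sup>2 \<partial>\<pi>) < r\<^sup>2 + e / (l + 1)"
    by (rule wasserstein_ball_near_optimal_coupling[OF P Q])
  note int = quadratic_form_integrable[OF Q2, of "spectral_matrix U x"]
    quadratic_form_integrable[OF P, of "spectral_matrix U (\<lambda>j. l * x j / (l - x j))"]
  note int\<pi> = couplings_marginal_integrals(1)[OF \<pi> int(1)]
    couplings_marginal_integrals(2)[OF \<pi> int(2)] coupling_cost_integrable[OF \<pi> Q2 P]
  have "(\<integral>w. ?q w \<partial>Q) = (\<integral>z. ?q (fst z) \<partial>\<pi>)"
    using couplings_marginal_integrals(3)[OF \<pi> int(1)] by simp
  also have "\<dots> \<le> (\<integral>z. l * (norm (fst z - snd z))\<^sup>2 + ?p (snd z) \<partial>\<pi>)"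
    using int\<pi> by (intro integral_mono transport_penalty_bound[OF U l(2)]) auto
  also have "\<dots> = l * (\<integral>z. (norm (fst z - snd z))\<^sup>2 \<partial>\<pi>) + (\<integral>v. ?p v \<partial>P)"
    using int\<pi> couplings_marginal_integrals(4)[OF \<pi> int(2)] by simp
  also have "l * (\<integral>z. (norm (fst z - snd z))\<^sup>2 \<partial>\<pi>) \<le> l * (r\<^sup>2 + e / (l + 1))"
    using cost l(1) by (intro mult_left_mono) auto
  also have "\<dots> \<le> l * r\<^sup>2 + e"
    using \<open>0 < e\<close> l(1) by (simp add: field_simps)
  finally show "(\<integral>w. ?q w \<partial>Q) \<le> l * r\<^sup>2 + (\<integral>v. ?p v \<partial>P) + e"
    by simp
qed

text \<open>
  The graph coupling $(Tv, v)$ bounds the distance between a distribution and its image.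
\<close>
lemma linear_pushforward_in_wasserstein_ball:
  fixes P :: "(real^'k) measure" and T :: "real^'k^'k"
  assumes P: "P \<in> P2" and cost: "(\<integral>v. (norm (T *v v - v))\<^sup>2 \<partial>P) \<le> r\<^sup>2" and r: "0 \<le> r"
  shows "distr P borel ((*v) T) \<in> wasserstein_ball P r"
proof -
  let ?Q = "distr P borel ((*v) T)"
  let ?cost = "\<lambda>\<pi>. \<integral>z. (norm (fst z - snd z))\<^sup>2 \<partial>\<pi>"
  let ?\<pi> = "distr P (borel \<Otimes>\<^sub>M borel) (\<lambda>v. (T *v v, v))"
  have prob: "prob_space P" and sets: "sets P = sets borel"
    using P by (simp_all add: P2_def)
  have meas: "(*v) T \<in> P \<rightarrow>\<^sub>M borel" "(\<lambda>v. (T *v v, v)) \<in> P \<rightarrow>\<^sub>M borel \<Otimes>\<^sub>M borel"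
    by (simp_all add: measurable_cong_sets[OF sets refl])
  have "(norm (T *v v))\<^sup>2 = v \<bullet> ((transpose T ** T) *v v)" for v
    using quadratic_form_congruence[of v T "mat 1"] by (simp add: power2_norm_eq_inner)
  then have "?Q \<in> P2"
    using quadratic_form_integrable[OF P, of "transpose T ** T"]
    by (simp add: P2_def prob_space.prob_space_distr[OF prob meas(1)] integrable_distr_eq[OF meas(1)])
  moreover have "?\<pi> \<in> couplings ?Q P"
    using prob_space.prob_space_distr[OF prob meas(2)] sets distr_id2[of borel P]
    by (simp add: couplings_def distr_distr[OF _ meas(2)] comp_def)
  then have "(INF \<pi>\<in>couplings ?Q P. ?cost \<pi>) \<le> ?cost ?\<pi>"
    by (intro cINF_lower bdd_belowI2[of _ 0]) (auto intro: integral_nonneg)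
  moreover have "?cost ?\<pi> = (\<integral>v. (norm (T *v v - v))\<^sup>2 \<partial>P)"
    by (subst integral_distr[OF meas(2)]) simp_all
  ultimately show ?thesis
    using cost r by (simp add: wasserstein_ball_def wasserstein2_def real_le_lsqrt)
qed

section \<open>Duality for a Gaussian centre\<close>

text \<open>
  The equation says that the derivative of
  $l\,r^2 + \sum_j a_j\,(x_j + x_j^2/(l - x_j))$ vanishes at $l$. A root is found by the intermediate
  value theorem: keeping only the summand of the largest eigenvalue $m$ bounds the sum from below,
  replacing every denominator by $l - m$ bounds it from above, and \<open>l1\<close> and \<open>l2\<close> are the
  points where these two bounds equal $r^2$.
\<close>
lemma dual_stationary_point_exists:
  fixes a x :: "'k::finite \<Rightarrow> real"
  assumes a: "\<And>j. 0 < a j" and x: "\<And>j. 0 \<le> x j" "x i \<noteq> 0" and r: "0 < r"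
  obtains l where "\<And>j. x j < l" "(\<Sum>j\<in>UNIV. a j * (x j / (l - x j))\<^sup>2) = r\<^sup>2"
proof -
  define g where "g l = (\<Sum>j\<in>UNIV. a j * (x j / (l - x j))\<^sup>2)" for l
  define m where "m = Max (range x)"
  have "m \<in> range x"
    unfolding m_def by (intro Max_in) auto
  then obtain k where k: "m = x k"
    by auto
  have xm: "x j \<le> m" for j
    by (simp add: m_def)
  have m: "0 < m"
    using xm[of i] x(1)[of i] x(2) by simp
  define C where "C = (\<Sum>j\<in>UNIV. a j * (x j)\<^sup>2)"
  have kC: "a k * m\<^sup>2 \<le> C"
    unfolding C_def k using a by (intro member_le_sum) (auto simp: less_imp_le)
  have km: "0 < a k * m\<^sup>2"
    using a m by simp
  define l1 where "l1 = m + sqrt (a k * m\<^sup>2) / r"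
  define l2 where "l2 = m + sqrt C / r"
  have l1: "m < l1" and l12: "l1 \<le> l2"
    using kC km r by (auto simp: l1_def l2_def divide_right_mono)
  have "\<exists>l\<ge>l1. l \<le> l2 \<and> g l = r\<^sup>2"
  proof (rule IVT2')
    have "r\<^sup>2 = a k * (x k / (l1 - x k))\<^sup>2"
      using r km a[of k] m by (simp add: l1_def power_divide flip: k)
        (simp add: power_mult_distrib field_simps)
    also have "\<dots> \<le> g l1"
      unfolding g_def using a by (intro member_le_sum) (auto simp: less_imp_le)
    finally show "r\<^sup>2 \<le> g l1" .
    have "g l2 \<le> (\<Sum>j\<in>UNIV. a j * (x j)\<^sup>2 / (l2 - m)\<^sup>2)"
      unfolding g_def
    proof (rule sum_mono)
      fix j
      have "x j / (l2 - x j) \<le> x j / (l2 - m)"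
        using xm[of j] l1 l12 x(1) by (intro divide_left_mono mult_pos_pos) auto
      moreover have "0 \<le> x j / (l2 - x j)"
        using xm[of j] l1 l12 x(1)[of j] by simp
      ultimately have "(x j / (l2 - x j))\<^sup>2 \<le> (x j / (l2 - m))\<^sup>2"
        by (intro power_mono)
      then show "a j * (x j / (l2 - x j))\<^sup>2 \<le> a j * (x j)\<^sup>2 / (l2 - m)\<^sup>2"
        using a[of j] by (simp add: power_divide mult_left_mono flip: times_divide_eq_right)
    qed
    also have "\<dots> = C / (sqrt C / r)\<^sup>2"
      by (simp add: C_def l2_def sum_divide_distrib)
    also have "\<dots> = r\<^sup>2"
      using kC km r by (simp add: power_divide)
    finally show "g l2 \<le> r\<^sup>2" .
    have "l - x j \<noteq> 0" if "l \<in> {l1..l2}" for l j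
      using that l1 xm[of j] by auto
    then show "continuous_on {l1..l2} g"
      unfolding g_def by (intro continuous_intros) auto
  qed (rule l12)
  then obtain l where "l1 \<le> l" "g l = r\<^sup>2"
    by blast
  then show thesis
    using l1 le_less_trans[OF xm, of l] by (intro that[of l]) (auto simp: g_def)
qed

lemma convex_on_finite_sum:
  assumes "convex I" "\<And>j. j \<in> J \<Longrightarrow> convex_on I (f j)"
  shows "convex_on I (\<lambda>l. \<Sum>j\<in>J. f j l :: real)"
  using assms(2)
  by (induction J rule: infinite_finite_induct) (auto simp: assms(1) convex_on_const intro: convex_on_add)

lemma convex_on_reciprocal_shift:
  fixes c x :: real
  assumes I: "convex I" "\<And>l. l \<in> I \<Longrightarrow> x < l" and c: "0 \<le> c"
  shows "convex_on I (\<lambda>l. c / (l - x))"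
proof -
  have inv: "convex_on {0<..} (inverse :: real \<Rightarrow> real)"
    by (rule convex_on_inverse) (simp_all add: convex_real_interval)
  have "convex_on I (\<lambda>l. inverse (l - x))"
  proof (rule convex_onI[OF _ I(1)])
    fix t l m :: real assume t: "0 < t" "t < 1" and "l \<in> I" "m \<in> I"
    then have "l - x \<in> {0<..}" "m - x \<in> {0<..}"
      using I(2) by auto
    from convex_onD[OF inv _ _ this, of t] t
    show "inverse ((1 - t) *\<^sub>R l + t *\<^sub>R m - x) \<le> (1 - t) * inverse (l - x) + t * inverse (m - x)"
      by (simp add: algebra_simps)
  qed
  from convex_on_cmul[OF c this] show ?thesis
    by (simp add: divide_inverse)
qed

text \<open>
  For any symmetric positive semidefinite cost matrix the dual value is an upper bound by weak
  duality. The images of the normal distribution under the matrices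
  \<open>spectral_matrix U t\<close> already exhaust it: such an image has transport cost
  $\sum_j a_j (t_j - 1)^2$ and expected cost $\sum_j a_j x_j t_j^2$, and the problem reduces to
  choosing the vector $t$. For a nonzero cost matrix the stationary point above is the optimal
  multiplier of this reduced problem; for the zero matrix the centre of the ball suffices.
\<close>
theorem gaussian_wasserstein_quadratic_duality:
  fixes X S :: "real^'k^'k"
  assumes X: "psd_matrix X" and S: "pd_matrix S" and r: "0 < r"
  shows "convex_on (dual_feasible X) (dual_objective S X r)"
    and "(SUP P\<in>wasserstein_ball (centered_normal S) r. ereal (\<integral>w. w \<bullet> (X *v w) \<partial>P)) =
      (INF l\<in>dual_feasible X. ereal (dual_objective S X r l))"
      (is "?sup = ?inf")
proof -
  obtain U x where U: "orthogonal_matrix U" and Xeq: "X = spectral_matrix U x"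
    using symmetric_matrix_diagonalization[of X] X by (auto simp: psd_matrix_def)
  have x: "0 \<le> x j" for j
    using psd_spectral_matrix_nonneg[OF U] X Xeq by simp
  define a where "a j = column j U \<bullet> (S *v column j U)" for j
  have a: "0 < a j" for j
    using S column_orthogonal_matrix_nonzero[OF U] by (simp add: a_def pd_matrix_def)
  have moment: "(\<integral>v. v \<bullet> (spectral_matrix U g *v v) \<partial>centered_normal S) = (\<Sum>j\<in>UNIV. a j * g j)" for g
    by (simp add: centered_normal_moments(4)[OF S] trace_mult_spectral_matrix a_def)
  have trS: "trace S = (\<Sum>j\<in>UNIV. a j)"
    using trace_mult_spectral_matrix[of S U "\<lambda>_. 1"] by (simp add: spectral_matrix_const[OF U] a_def)
  have resolvent: "mat l - X = spectral_matrix U (\<lambda>j. l - x j)" for l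
    by (simp add: Xeq spectral_matrix_diff flip: spectral_matrix_const[OF U])
  have feas: "dual_feasible X = {l. \<forall>j. x j < l}"
    by (simp add: dual_feasible_def resolvent pd_spectral_matrix_iff[OF U])
  have obj: "dual_objective S X r l = l * r\<^sup>2 + (\<Sum>j\<in>UNIV. a j * (l * x j / (l - x j)))"
    if "\<And>j. x j < l" for l
  proof -
    have ne: "l - x j \<noteq> 0" for j
      using that[of j] by simp
    have "dual_objective S X r l =
        l * r\<^sup>2 + (\<Sum>j\<in>UNIV. l * (l * (a j * (1 / (l - x j))) - a j))"
      by (simp add: dual_objective_def resolvent matrix_inv_spectral_matrix[OF U ne]
          trace_mult_spectral_matrix trS flip: a_def)
        (simp add: sum_distrib_left sum_subtractf algebra_simps)
    also have "(\<Sum>j\<in>UNIV. l * (l * (a j * (1 / (l - x j))) - a j)) =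
        (\<Sum>j\<in>UNIV. a j * (l * x j / (l - x j)))"
      using ne by (intro sum.cong) (auto simp: field_simps)
    finally show ?thesis .
  qed

  have "convex (dual_feasible X)"
  proof -
    have "dual_feasible X = (\<Inter>j. {x j<..})"
      by (auto simp: feas)
    then show ?thesis
      by (simp add: convex_INT)
  qed
  then have "convex_on (dual_feasible X) (\<lambda>l. l * r\<^sup>2)"
    by (simp add: convex_on_def algebra_simps)
  with \<open>convex (dual_feasible X)\<close> have "convex_on (dual_feasible X)
      (\<lambda>l. l * r\<^sup>2 + (\<Sum>j\<in>UNIV. a j * x j + a j * (x j)\<^sup>2 / (l - x j)))"
    using a by (intro convex_on_add convex_on_finite_sum convex_on_reciprocal_shift)
      (auto simp: feas less_imp_le convex_on_const)
  moreover have "dual_objective S X r l =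
      l * r\<^sup>2 + (\<Sum>j\<in>UNIV. a j * x j + a j * (x j)\<^sup>2 / (l - x j))" if "l \<in> dual_feasible X" for l
  proof -
    have l: "x j < l" for j
      using that by (simp add: feas)
    have "a j * (l * x j / (l - x j)) = a j * x j + a j * (x j)\<^sup>2 / (l - x j)" for j
      using l[of j] by (simp add: field_simps power2_eq_square)
    then show ?thesis
      by (simp add: obj[OF l])
  qed
  ultimately show "convex_on (dual_feasible X) (dual_objective S X r)"
    by (simp add: convex_on_def convex_def)

  show "?sup = ?inf"
  proof (rule antisym)
    show "?sup \<le> ?inf"
    proof (intro SUP_least INF_greatest, simp only: ereal_less_eq)
      fix P l assume P: "P \<in> wasserstein_ball (centered_normal S) r" and l: "l \<in> dual_feasible X"
      have l: "x j < l" for j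
        using l by (simp add: feas)
      have "0 \<le> l"
        using l x by (meson less_imp_le order_trans)
      from wasserstein_weak_duality[where x = x, OF U this l centered_normal_in_P2[OF S] P]
      show "(\<integral>w. w \<bullet> (X *v w) \<partial>P) \<le> dual_objective S X r l"
        by (simp only: obj[OF l] moment flip: Xeq)
    qed
    \<comment> \<open>the cost and the value of the image of the normal distribution under $U\,\mathrm{diag}(t)\,U^T$\<close>
    have attain: "ereal (\<Sum>j\<in>UNIV. a j * (x j * (t j)\<^sup>2)) \<le> ?sup"
      if cost: "(\<Sum>j\<in>UNIV. a j * (t j - 1)\<^sup>2) \<le> r\<^sup>2" for t
    proof -
      let ?T = "spectral_matrix U t"
      let ?P = "distr (centered_normal S) borel ((*v) ?T)"
      have meas: "(*v) ?T \<in> centered_normal S \<rightarrow>\<^sub>M borel"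
        by (simp add: measurable_cong_sets[OF centered_normal_moments(2)[OF S] refl])
      have "?T *v v - v = spectral_matrix U (\<lambda>j. t j - 1) *v v" for v
        by (simp add: spectral_matrix_const[OF U] matrix_vector_mult_diff_rdistrib
            flip: spectral_matrix_diff)
      then have "(norm (?T *v v - v))\<^sup>2 = v \<bullet> (spectral_matrix U (\<lambda>j. (t j - 1)\<^sup>2) *v v)" for v
        using quadratic_form_congruence[of v "spectral_matrix U (\<lambda>j. t j - 1)" "mat 1"]
        by (simp add: power2_norm_eq_inner spectral_matrix_mult[OF U] flip: power2_eq_square)
      then have "?P \<in> wasserstein_ball (centered_normal S) r"
        using cost r
        by (intro linear_pushforward_in_wasserstein_ball centered_normal_in_P2[OF S])
          (auto simp: moment)
      then have "ereal (\<integral>w. w \<bullet> (X *v w) \<partial>?P) \<le> ?sup"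
        by (rule SUP_upper)
      also have "(\<integral>w. w \<bullet> (X *v w) \<partial>?P) =
          (\<integral>v. (?T *v v) \<bullet> (X *v (?T *v v)) \<partial>centered_normal S)"
        by (rule integral_distr[OF meas]) measurable
      also have "\<dots> = (\<integral>v. v \<bullet> (spectral_matrix U (\<lambda>j. x j * (t j)\<^sup>2) *v v) \<partial>centered_normal S)"
        by (simp add: Xeq spectral_matrix_mult[OF U] power2_eq_square mult_ac
            flip: quadratic_form_congruence)
      finally show ?thesis
        by (simp only: moment)
    qed
    show "?inf \<le> ?sup"
    proof (cases "\<forall>j. x j = 0")
      case True
      have "0 \<le> ?sup"
        \<comment> \<open>the centre of the ball itself\<close>
        using attain[of "\<lambda>_. 1"] True by (simp add: zero_ereal_def)
      moreover have "?inf \<le> 0"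
      proof (rule ereal_le_epsilon2)
        show "?inf \<le> 0 + ereal e" if "0 < e" for e
        proof -
          from that r have "x j < e / r\<^sup>2" for j
            using True by simp
          then have "e / r\<^sup>2 \<in> dual_feasible X" "dual_objective S X r (e / r\<^sup>2) = e"
            using obj[of "e / r\<^sup>2"] True r by (simp_all add: feas)
          then show "?inf \<le> 0 + ereal e"
            by (metis (mono_tags, lifting) INF_lower add_0)
        qed
      qed
      ultimately show ?thesis
        by (rule order_trans[rotated])
    next
      case False
      then obtain i where "x i \<noteq> 0"
        by auto
      then obtain l where l: "\<And>j. x j < l"
        and stat: "(\<Sum>j\<in>UNIV. a j * (x j / (l - x j))\<^sup>2) = r\<^sup>2"
        using dual_stationary_point_exists[of a x i r] a x r by metis
      have ne: "l - x j \<noteq> 0" for j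
        using l[of j] by simp
      \<comment> \<open>$t_j = l/(l - x_j)$ is the maximizer in the pointwise transport bound\<close>
      have "l / (l - x j) - 1 = x j / (l - x j)" for j
        using ne[of j] by (simp add: field_simps)
      then have "ereal (\<Sum>j\<in>UNIV. a j * (x j * (l / (l - x j))\<^sup>2)) \<le> ?sup"
        using stat by (intro attain) simp
      also have "(\<Sum>j\<in>UNIV. a j * (x j * (l / (l - x j))\<^sup>2)) =
          (\<Sum>j\<in>UNIV. l * (a j * (x j / (l - x j))\<^sup>2) + a j * (l * x j / (l - x j)))"
      proof (intro sum.cong refl)
        fix j
        have "x j * l\<^sup>2 = l * (x j)\<^sup>2 + l * x j * (l - x j)"
          by (simp add: power2_eq_square algebra_simps)
        then have "x j * (l / (l - x j))\<^sup>2 = (l * (x j)\<^sup>2 + l * x j * (l - x j)) / (l - x j)\<^sup>2"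
          by (simp add: power_divide)
        also have "\<dots> = l * (x j / (l - x j))\<^sup>2 + l * x j / (l - x j)"
          using ne[of j] by (simp add: add_divide_distrib power_divide power2_eq_square)
        finally show "a j * (x j * (l / (l - x j))\<^sup>2) =
            l * (a j * (x j / (l - x j))\<^sup>2) + a j * (l * x j / (l - x j))"
          by (simp add: distrib_left mult.left_commute)
      qed
      also have "\<dots> = l * r\<^sup>2 + (\<Sum>j\<in>UNIV. a j * (l * x j / (l - x j)))"
        by (simp only: sum.distrib stat flip: sum_distrib_left)
      also have "\<dots> = dual_objective S X r l"
        by (rule obj[OF l, symmetric])
      finally have "ereal (dual_objective S X r l) \<le> ?sup" .
      moreover have "l \<in> dual_feasible X"
        using l by (simp add: feas)
      ultimately show ?thesis
        by (rule INF_lower2[rotated])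
    qed
  qed
qed

theorem theorem4:
  fixes A :: "real^'n^'n" and B :: "real^'m^'n" and D :: "real^'d^'n"
    and Q :: "'N::{finite,linorder} \<Rightarrow> real^'n^'n"
    and R :: "'N \<Rightarrow> real^'m^'m"
    and K L :: "real^('N option \<times> 'n)^('N \<times> 'm)"
    and \<Sigma>\<^sub>w :: "real^('N \<times> 'd)^('N \<times> 'd)"
    and \<epsilon> :: real
  assumes "\<And>k. psd_matrix (Q k)"
    and "\<And>k. pd_matrix (R k)"
    and "pd_matrix \<Sigma>\<^sub>w"
    and "\<epsilon> > 0"
    and "block_lower_triangular K"
    and "L = K ** matrix_inv (mat 1 - stacked_input A B ** K)"
  shows "psd_matrix (Xi A B D Q R L) \<and>
    convex_on (dual_feasible (Xi A B D Q R L)) (dual_objective \<Sigma>\<^sub>w (Xi A B D Q R L) \<epsilon>) \<and>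
    (SUP P\<in>wasserstein_ball (centered_normal \<Sigma>\<^sub>w) \<epsilon>.
        ereal (\<integral>w. w \<bullet> (Xi A B D Q R L *v w) \<partial>P)) =
    (INF l\<in>dual_feasible (Xi A B D Q R L).
        ereal (dual_objective \<Sigma>\<^sub>w (Xi A B D Q R L) \<epsilon> l))"
proof (intro conjI)
  show psd: "psd_matrix (Xi A B D Q R L)"
    by (intro psd_matrix_Xi pd_matrix_imp_psd_matrix assms(1,2))
  show "convex_on (dual_feasible (Xi A B D Q R L)) (dual_objective \<Sigma>\<^sub>w (Xi A B D Q R L) \<epsilon>)"
    by (rule gaussian_wasserstein_quadratic_duality(1)[OF psd assms(3,4)])
  show "(SUP P\<in>wasserstein_ball (centered_normal \<Sigma>\<^sub>w) \<epsilon>.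
        ereal (\<integral>w. w \<bullet> (Xi A B D Q R L *v w) \<partial>P)) =
    (INF l\<in>dual_feasible (Xi A B D Q R L).
        ereal (dual_objective \<Sigma>\<^sub>w (Xi A B D Q R L) \<epsilon> l))"
    by (rule gaussian_wasserstein_quadratic_duality(2)[OF psd assms(3,4)])
qed

end
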